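(* Let $(Q,+)$ be a group, $\varphi,\psi\in Aut(Q,+)$, and $\beta,\delta\in S_Q$. The left linear quasigroups $(Q,\cdot)$ and $(Q,\circ)$ given by $x\cdot y=\varphi x+\beta y$ and $x\circ y=\psi x+\delta y$ are orthogonal if and only if the mapping $(-\varphi^{-1}\beta+\psi^{-1}\delta)$, i.e. $y\mapsto-\varphi^{-1}\beta y+\psi^{-1}\delta y$, is a permutation of the set $Q$.
   Context: Groups are written additively but need not be commutative. $S_Q$ is the set of all permutations (bijections) of the set $Q$. Products of maps are compositions, $(\alpha\beta)x=\alpha(\beta x)$. Two quasigroups $(Q,\cdot)$ and $(Q,\circ)$ on the same set are orthogonal if for all $a,b\in Q$ the system $x\cdot y=a$, $x\circ y=b$ has a unique solution $(x,y)\in Q\times Q$. A quasigroup of the form $x\cdot y=\varphi x+\beta y$ with $\varphi\in Aut(Q,+)$, $\beta\in S_Q$ is called left linear. *)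

theory Defs
  imports "HOL-Algebra.Bij"
begin

definition quasigroup :: "'a set \<Rightarrow> ('a \<Rightarrow> 'a \<Rightarrow> 'a) \<Rightarrow> bool" where
  "quasigroup Q f \<longleftrightarrow>
     (\<forall>x\<in>Q. \<forall>y\<in>Q. f x y \<in> Q) \<and>
     (\<forall>a\<in>Q. \<forall>b\<in>Q. \<exists>!x. x \<in> Q \<and> f x a = b) \<and>
     (\<forall>a\<in>Q. \<forall>b\<in>Q. \<exists>!y. y \<in> Q \<and> f a y = b)"

definition orthogonal_quasigroups ::
    "'a set \<Rightarrow> ('a \<Rightarrow> 'a \<Rightarrow> 'a) \<Rightarrow> ('a \<Rightarrow> 'a \<Rightarrow> 'a) \<Rightarrow> bool" where
  "orthogonal_quasigroups Q f g \<longleftrightarrow>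
     quasigroup Q f \<and> quasigroup Q g \<and>
     (\<forall>a\<in>Q. \<forall>b\<in>Q. \<exists>!p. p \<in> Q \<times> Q \<and>
        f (fst p) (snd p) = a \<and> g (fst p) (snd p) = b)"

text \<open>
  Groups are the multiplicatively written records of HOL-Algebra, so the additive
  \<open>\<phi> x + \<beta> y\<close> reads \<open>\<phi> x \<otimes> \<beta> y\<close>, and \<open>- x\<close> reads \<open>inv x\<close>. Commutativity is not assumed,
  so the order of the factors matters. \<open>Aut(Q,+)\<close> is \<^const>\<open>auto\<close> and \<open>S\<^sub>Q\<close> is
  \<^const>\<open>Bij\<close>. Both consist of functions that are \<^const>\<open>undefined\<close> outside the carrier.
\<close>

definition left_linear_op ::
    "('a, 'b) monoid_scheme \<Rightarrow> ('a \<Rightarrow> 'a) \<Rightarrow> ('a \<Rightarrow> 'a) \<Rightarrow> 'a \<Rightarrow> 'a \<Rightarrow> 'a" where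
  "left_linear_op G \<phi> \<beta> x y = \<phi> x \<otimes>\<^bsub>G\<^esub> \<beta> y"

end

theory Submission
  imports Defs
begin

text \<open>
  Applying \<open>\<phi>\<inverse>\<close> and \<open>\<psi>\<inverse>\<close> to the two equations turns the system into
  \<open>x \<otimes> u y = a\<close>, \<open>x \<otimes> v y = b\<close> with \<open>u = \<phi>\<inverse>\<beta>\<close> and \<open>v = \<psi>\<inverse>\<delta>\<close>. The first equation
  determines \<open>x\<close> from \<open>y\<close>, and eliminating it leaves \<open>inv (u y) \<otimes> v y = inv a \<otimes> b\<close>,
  whose right-hand side runs over the whole group.
\<close>

text \<open>Orthogonality and the quasigroup laws are phrased through unique solvability; this is
  the bridge to \<open>bij_betw\<close>. Injectivity in the converse needs \<open>f\<close> to map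
  into \<open>B\<close>: two arguments with a common value both solve the equation for that value,
  which must lie in \<open>B\<close>.\<close>

lemma bij_betw_iff_ex1:
  assumes "f \<in> A \<rightarrow> B"
  shows "bij_betw f A B \<longleftrightarrow> (\<forall>b\<in>B. \<exists>!y. y \<in> A \<and> f y = b)"
proof
  assume "bij_betw f A B"
  then show "\<forall>b\<in>B. \<exists>!y. y \<in> A \<and> f y = b"
    unfolding bij_betw_def inj_on_def by blast
next
  assume *: "\<forall>b\<in>B. \<exists>!y. y \<in> A \<and> f y = b"
  have "inj_on f A"
    using * assms by (metis PiE inj_onI)
  moreover have "f ` A = B"
    using * assms by blast
  ultimately show "bij_betw f A B"
    by (simp add: bij_betw_def)
qed

text \<open>Second projection is injective on the set of pairs \<open>(f y, y)\<close>, so an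
  unknown given explicitly by the other one can be eliminated without affecting uniqueness.\<close>

lemma ex1_graph_iff: "(\<exists>!p. P (snd p) \<and> fst p = f (snd p)) \<longleftrightarrow> (\<exists>!y. P y)"
proof
  assume "\<exists>!p. P (snd p) \<and> fst p = f (snd p)"
  then obtain p where "P (snd p)" and "\<And>q. P (snd q) \<Longrightarrow> fst q = f (snd q) \<Longrightarrow> q = p"
    by blast
  then show "\<exists>!y. P y"
    by (metis fst_conv snd_conv)
next
  assume "\<exists>!y. P y"
  then obtain y where "P y" and "\<And>z. P z \<Longrightarrow> z = y"
    by blast
  then show "\<exists>!p. P (snd p) \<and> fst p = f (snd p)"
    by (metis fst_conv snd_conv prod.collapse)
qed

lemma auto_imp_bij_betw: "\<phi> \<in> auto G \<Longrightarrow> bij_betw \<phi> (carrier G) (carrier G)"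
  by (simp add: auto_def Bij_def)

lemma auto_imp_hom: "\<phi> \<in> auto G \<Longrightarrow> \<phi> \<in> hom G G"
  by (simp add: auto_def)

context group
begin

text \<open>Cancelling the known factor in the group leaves \<open>\<phi> x = c\<close> or
  \<open>\<beta> y = c\<close>, uniquely solvable by bijectivity.\<close>

lemma quasigroup_left_linear_op:
  assumes \<phi>: "bij_betw \<phi> (carrier G) (carrier G)" and \<beta>: "bij_betw \<beta> (carrier G) (carrier G)"
  shows "quasigroup (carrier G) (left_linear_op G \<phi> \<beta>)"
  unfolding quasigroup_def left_linear_op_def
proof (intro conjI ballI)
  have \<phi>': "\<phi> \<in> carrier G \<rightarrow> carrier G" and \<beta>': "\<beta> \<in> carrier G \<rightarrow> carrier G"
    using \<phi> \<beta> by (auto simp: bij_betw_def)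
  fix a b assume ab: "a \<in> carrier G" "b \<in> carrier G"
  note mem = funcset_mem[OF \<phi>'] funcset_mem[OF \<beta>']
  show "\<phi> a \<otimes> \<beta> b \<in> carrier G"
    using ab mem by simp
  have "(x \<in> carrier G \<and> \<phi> x \<otimes> \<beta> a = b) \<longleftrightarrow> (x \<in> carrier G \<and> \<phi> x = b \<otimes> inv \<beta> a)" for x
    using ab mem by (metis inv_solve_right')
  moreover have "b \<otimes> inv \<beta> a \<in> carrier G"
    using ab mem by simp
  ultimately show "\<exists>!x. x \<in> carrier G \<and> \<phi> x \<otimes> \<beta> a = b"
    using \<phi> bij_betw_iff_ex1[OF \<phi>'] by simp
  have "(y \<in> carrier G \<and> \<phi> a \<otimes> \<beta> y = b) \<longleftrightarrow> (y \<in> carrier G \<and> \<beta> y = inv \<phi> a \<otimes> b)" for y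
    using ab mem by (metis inv_solve_left)
  moreover have "inv \<phi> a \<otimes> b \<in> carrier G"
    using ab mem by simp
  ultimately show "\<exists>!y. y \<in> carrier G \<and> \<phi> a \<otimes> \<beta> y = b"
    using \<beta> bij_betw_iff_ex1[OF \<beta>'] by simp
qed

text \<open>Writing \<open>w\<close> as the image of its preimage, the homomorphism law collects the
  left side into a single value of \<open>\<phi>\<close>, which injectivity then strips from both
  sides.\<close>

lemma automorphism_mult_eq_iff:
  assumes \<phi>: "\<phi> \<in> auto G" and x: "x \<in> carrier G" "w \<in> carrier G" "a \<in> carrier G"
  shows "\<phi> x \<otimes> w = \<phi> a \<longleftrightarrow> x \<otimes> inv_into (carrier G) \<phi> w = a"
proof -
  let ?u = "inv_into (carrier G) \<phi> w"
  note bij = auto_imp_bij_betw[OF \<phi>]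
  have u: "?u \<in> carrier G" "\<phi> ?u = w"
    using bij x by (auto simp: bij_betw_def inv_into_into f_inv_into_f)
  then have "\<phi> x \<otimes> w = \<phi> (x \<otimes> ?u)"
    using hom_mult[OF auto_imp_hom[OF \<phi>] x(1) u(1)] by simp
  then show ?thesis
    using bij u x by (metis bij_betw_def inj_on_eq_iff m_closed)
qed

lemma ex1_translate_system_iff:
  assumes "u \<in> carrier G \<rightarrow> carrier G" "v \<in> carrier G \<rightarrow> carrier G"
    and ab: "a \<in> carrier G" "b \<in> carrier G"
  shows "(\<exists>!p. p \<in> carrier G \<times> carrier G \<and> fst p \<otimes> u (snd p) = a \<and> fst p \<otimes> v (snd p) = b)
    \<longleftrightarrow> (\<exists>!y. y \<in> carrier G \<and> inv (u y) \<otimes> v y = inv a \<otimes> b)"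
proof -
  have mem: "u y \<in> carrier G" "v y \<in> carrier G" if "y \<in> carrier G" for y
    using that assms by auto
  have sys: "x \<otimes> u y = a \<and> x \<otimes> v y = b \<longleftrightarrow>
      x = a \<otimes> inv (u y) \<and> inv (u y) \<otimes> v y = inv a \<otimes> b"
    if xy: "x \<in> carrier G" "y \<in> carrier G" for x y
  proof -
    have "x \<otimes> u y = a \<longleftrightarrow> x = a \<otimes> inv (u y)"
      using xy mem ab by (metis inv_solve_right')
    moreover have "a \<otimes> inv (u y) \<otimes> v y = b \<longleftrightarrow> inv (u y) \<otimes> v y = inv a \<otimes> b"
      using mem[OF xy(2)] ab inv_solve_left[of "inv (u y) \<otimes> v y" a b]
      by (metis inv_closed m_assoc m_closed)
    ultimately show ?thesis by metis
  qed
  \<comment> \<open>This is the graph form expected by \<open>ex1_graph_iff\<close>. Membership of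
    \<open>fst p\<close> in the carrier disappears because the formula for \<open>fst p\<close>
    already forces it.\<close>
  have p: "p \<in> carrier G \<times> carrier G \<and> fst p \<otimes> u (snd p) = a \<and> fst p \<otimes> v (snd p) = b \<longleftrightarrow>
      (snd p \<in> carrier G \<and> inv (u (snd p)) \<otimes> v (snd p) = inv a \<otimes> b) \<and>
      fst p = a \<otimes> inv (u (snd p))" for p
    using sys[of "fst p" "snd p"] mem[of "snd p"] ab
    by (metis inv_closed m_closed mem_Times_iff)
  show ?thesis
    unfolding p by (rule ex1_graph_iff)
qed

end

theorem theorem23:
  fixes G :: "('a, 'b) monoid_scheme" (structure)
    and \<phi> \<psi> \<beta> \<delta> :: "'a \<Rightarrow> 'a"
  assumes "group G"
    and "\<phi> \<in> auto G" and "\<psi> \<in> auto G"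
    and "\<beta> \<in> Bij (carrier G)" and "\<delta> \<in> Bij (carrier G)"
  shows "orthogonal_quasigroups (carrier G) (left_linear_op G \<phi> \<beta>) (left_linear_op G \<psi> \<delta>)
    \<longleftrightarrow> (\<lambda>y\<in>carrier G. inv (inv_into (carrier G) \<phi> (\<beta> y)) \<otimes> inv_into (carrier G) \<psi> (\<delta> y))
          \<in> Bij (carrier G)"
proof -
  interpret group G by fact
  let ?C = "carrier G"
  define u where "u y = inv_into ?C \<phi> (\<beta> y)" for y
  define v where "v y = inv_into ?C \<psi> (\<delta> y)" for y
  let ?d = "\<lambda>y. inv (u y) \<otimes> v y"
  have \<phi>: "bij_betw \<phi> ?C ?C" and \<psi>: "bij_betw \<psi> ?C ?C"
    using assms by (simp_all add: auto_imp_bij_betw)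
  have \<beta>: "bij_betw \<beta> ?C ?C" and \<delta>: "bij_betw \<delta> ?C ?C"
    using assms by (auto simp: Bij_def)
  have \<beta>C: "\<beta> y \<in> ?C" and \<delta>C: "\<delta> y \<in> ?C" if "y \<in> ?C" for y
    using that \<beta> \<delta> by (auto simp: bij_betw_def)
  have u: "u \<in> ?C \<rightarrow> ?C" and v: "v \<in> ?C \<rightarrow> ?C"
    using \<phi> \<psi> \<beta>C \<delta>C by (auto simp: u_def v_def bij_betw_def inv_into_into)
  have d: "?d \<in> ?C \<rightarrow> ?C"
    using u v by auto
  let ?S = "\<lambda>a b p. p \<in> ?C \<times> ?C \<and>
    left_linear_op G \<phi> \<beta> (fst p) (snd p) = a \<and> left_linear_op G \<psi> \<delta> (fst p) (snd p) = b"
  \<comment> \<open>The right-hand sides are parametrized as \<open>\<phi> a\<close> and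
    \<open>\<psi> b\<close>, so that removing the automorphisms leaves plain \<open>a\<close> and
    \<open>b\<close>.\<close>
  have S: "(\<exists>!p. ?S (\<phi> a) (\<psi> b) p) \<longleftrightarrow> (\<exists>!y. y \<in> ?C \<and> ?d y = inv a \<otimes> b)"
    if ab: "a \<in> ?C" "b \<in> ?C" for a b
  proof -
    have "?S (\<phi> a) (\<psi> b) p \<longleftrightarrow>
        p \<in> ?C \<times> ?C \<and> fst p \<otimes> u (snd p) = a \<and> fst p \<otimes> v (snd p) = b" for p
      using automorphism_mult_eq_iff[OF assms(2) _ \<beta>C ab(1), of "fst p" "snd p"]
        automorphism_mult_eq_iff[OF assms(3) _ \<delta>C ab(2), of "fst p" "snd p"]
      unfolding left_linear_op_def u_def v_def mem_Times_iff by blast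
    then show ?thesis
      using ex1_translate_system_iff[OF u v ab] by simp
  qed
  \<comment> \<open>Surjectivity of \<open>\<phi>\<close> and \<open>\<psi>\<close> lets the
    right-hand sides range over their images, matching the form of \<open>S\<close>.\<close>
  have "orthogonal_quasigroups ?C (left_linear_op G \<phi> \<beta>) (left_linear_op G \<psi> \<delta>)
      \<longleftrightarrow> (\<forall>a\<in>\<phi> ` ?C. \<forall>b\<in>\<psi> ` ?C. \<exists>!p. ?S a b p)"
    using \<phi> \<psi> \<beta> \<delta> quasigroup_left_linear_op
    by (simp add: orthogonal_quasigroups_def bij_betw_imp_surj_on)
  also have "\<dots> \<longleftrightarrow> (\<forall>a\<in>?C. \<forall>b\<in>?C. \<exists>!y. y \<in> ?C \<and> ?d y = inv a \<otimes> b)"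
    using S by simp
  also have "\<dots> \<longleftrightarrow> (\<forall>c\<in>?C. \<exists>!y. y \<in> ?C \<and> ?d y = c)"
  proof
    assume *: "\<forall>a\<in>?C. \<forall>b\<in>?C. \<exists>!y. y \<in> ?C \<and> ?d y = inv a \<otimes> b"
    show "\<forall>c\<in>?C. \<exists>!y. y \<in> ?C \<and> ?d y = c"
    proof
      fix c assume "c \<in> ?C"
      then show "\<exists>!y. y \<in> ?C \<and> ?d y = c"
        \<comment> \<open>With \<open>a\<close> the unit and \<open>b = c\<close>, the product
          \<open>inv a \<otimes> b\<close> is \<open>c\<close>; hence every element is
          reached.\<close>
        using bspec[OF bspec[OF * one_closed], of c] by simp
    qed
  next
    assume *: "\<forall>c\<in>?C. \<exists>!y. y \<in> ?C \<and> ?d y = c"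
    show "\<forall>a\<in>?C. \<forall>b\<in>?C. \<exists>!y. y \<in> ?C \<and> ?d y = inv a \<otimes> b"
      by (intro ballI bspec[OF *]) simp
  qed
  also have "\<dots> \<longleftrightarrow> bij_betw ?d ?C ?C"
    by (rule bij_betw_iff_ex1[OF d, symmetric])
  \<comment> \<open>\<open>Bij\<close> also demands extensionality; restricting to the carrier
    supplies it and leaves the values there unchanged.\<close>
  also have "\<dots> \<longleftrightarrow> (\<lambda>y\<in>?C. ?d y) \<in> Bij ?C"
    by (simp add: Bij_def cong: bij_betw_cong)
  finally show ?thesis
    by (simp add: u_def v_def)
qed

end
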